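(* Suppose that $\mathbf V$ is any proper monoid variety that is a modular element of the lattice $\mathbb{MON}$ of all monoid varieties. Then $\mathbf V$ satisfies the identities \[x^2\approx x^3\qquad\text{and}\qquad x^2y\approx yx^2.\]
   Context: Monoids are considered as semigroups with an identity element that is fixed by a 0-ary operation, and a monoid variety is a class of monoids definable by identities between (possibly empty) words, the empty word being interpreted as the identity element. A monoid variety is proper if it is different from the variety of all monoids. $\mathbb{MON}$ denotes the lattice of all monoid varieties ordered by inclusion; the meet is intersection and the join of two varieties is the smallest monoid variety containing both. An element $x$ of a lattice $L$ is modular if for all $y,z\in L$: $y\le z$ implies $(x\wedge z)\vee y=(x\vee y)\wedge z$. *)

theory Defs
  imports "HOL-Algebra.Complete_Lattice" "HOL-Algebra.Group"
    "HOL-Library.Infinite_Typeclass" "HOL-Library.Countable_Set"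
begin

text \<open>Words over a countably infinite alphabet of letters; the empty word takes the value \<open>\<one>\<close>.\<close>

type_synonym word = "nat list"

definition eval_word :: "('a, 'b) monoid_scheme \<Rightarrow> (nat \<Rightarrow> 'a) \<Rightarrow> word \<Rightarrow> 'a" where
  "eval_word M \<phi> w = foldr (\<lambda>x a. \<phi> x \<otimes>\<^bsub>M\<^esub> a) w \<one>\<^bsub>M\<^esub>"

definition holds_in :: "('a, 'b) monoid_scheme \<Rightarrow> word \<Rightarrow> word \<Rightarrow> bool" where
  "holds_in M u v \<longleftrightarrow> (\<forall>\<phi> \<in> UNIV \<rightarrow> carrier M. eval_word M \<phi> u = eval_word M \<phi> v)"

definition satisfies_identity :: "'a monoid set \<Rightarrow> word \<Rightarrow> word \<Rightarrow> bool" where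
  "satisfies_identity V u v \<longleftrightarrow> (\<forall>M \<in> V. holds_in M u v)"

definition all_monoids :: "'a monoid set" where
  "all_monoids = {M. monoid M}"

definition models_of :: "(word \<times> word) set \<Rightarrow> 'a monoid set" where
  "models_of \<Sigma> = {M \<in> all_monoids. \<forall>(u, v) \<in> \<Sigma>. holds_in M u v}"

definition monoid_variety :: "'a monoid set \<Rightarrow> bool" where
  "monoid_variety V \<longleftrightarrow> (\<exists>\<Sigma>. V = models_of \<Sigma>)"

text \<open>
  A class of monoids is a set of monoids whose carriers are subsets of a type \<open>'a\<close>. As soon as
  \<open>'a\<close> is infinite, this gives the lattice of all varieties: whether every model of \<open>\<Sigma>\<close> is a
  model of \<open>\<Sigma>'\<close> can be decided on the models of \<open>\<Sigma>\<close> inside \<open>'a\<close>, see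
  \<open>models_of_subset_any_type\<close> below. Over a finite \<open>'a\<close> distinct varieties would be identified,
  hence the sort constraint.
\<close>

definition MON :: "('a::infinite) monoid set gorder" where
  "MON = \<lparr>carrier = {V. monoid_variety V}, eq = (=), le = (\<subseteq>)\<rparr>"

definition modular_element :: "('l, 'b) gorder_scheme \<Rightarrow> 'l \<Rightarrow> bool" where
  "modular_element L x \<longleftrightarrow> x \<in> carrier L \<and>
     (\<forall>y \<in> carrier L. \<forall>z \<in> carrier L. y \<sqsubseteq>\<^bsub>L\<^esub> z \<longrightarrow>
        (x \<sqinter>\<^bsub>L\<^esub> z) \<squnion>\<^bsub>L\<^esub> y = (x \<squnion>\<^bsub>L\<^esub> y) \<sqinter>\<^bsub>L\<^esub> z)"

lemma monoid_variety_Inter: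
  assumes "\<And>V. V \<in> A \<Longrightarrow> monoid_variety V"
  shows "monoid_variety (all_monoids \<inter> \<Inter>A)"
proof -
  let ?S = "{(u, v). \<exists>V\<in>A. satisfies_identity V u v}"
  have "models_of ?S \<subseteq> V" if VA: "V \<in> A" for V
  proof -
    obtain S where S: "V = models_of S" using assms[OF VA] unfolding monoid_variety_def by blast
    have "satisfies_identity V u v" if "(u, v) \<in> S" for u v
      using that unfolding S satisfies_identity_def models_of_def by auto
    then have "S \<subseteq> ?S" using VA by auto
    then show ?thesis unfolding S models_of_def by blast
  qed
  then have "all_monoids \<inter> \<Inter>A = models_of ?S"
    by (auto simp: models_of_def satisfies_identity_def)
  then show ?thesis by (auto simp: monoid_variety_def)
qed

lemma monoid_variety_all_monoids: "monoid_variety all_monoids"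
  using monoid_variety_Inter[of "{}"] by simp

lemma monoid_variety_subset: "monoid_variety V \<Longrightarrow> V \<subseteq> all_monoids"
  by (auto simp: monoid_variety_def models_of_def)

lemma monoid_variety_Int:
  assumes "monoid_variety V" "monoid_variety W" shows "monoid_variety (V \<inter> W)"
proof -
  have "all_monoids \<inter> \<Inter>{V, W} = V \<inter> W" using assms monoid_variety_subset by auto
  then show ?thesis using monoid_variety_Inter[of "{V, W}"] assms by auto
qed

lemma greatest_Lower_MON:
  assumes "monoid_variety V" "monoid_variety W"
  shows "greatest MON (V \<inter> W) (Lower MON {V, W})"
  using assms monoid_variety_Int by (auto simp: greatest_def Lower_def MON_def)

lemma least_Upper_MON:
  assumes "monoid_variety V" "monoid_variety W"
  shows "least MON (\<Inter>{U. monoid_variety U \<and> V \<union> W \<subseteq> U}) (Upper MON {V, W})"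
proof -
  let ?A = "{U. monoid_variety U \<and> V \<union> W \<subseteq> U}"
  have "all_monoids \<in> ?A"
    using assms monoid_variety_all_monoids monoid_variety_subset by auto
  then have "all_monoids \<inter> \<Inter>?A = \<Inter>?A" by auto
  then have "monoid_variety (\<Inter>?A)" using monoid_variety_Inter[of ?A] by auto
  then show ?thesis using assms by (auto simp: least_def Upper_def MON_def)
qed

lemma lattice_MON: "lattice (MON :: ('a::infinite) monoid set gorder)"
proof -
  interpret partial_order "MON :: 'a monoid set gorder" by unfold_locales (auto simp: MON_def)
  show ?thesis
  proof unfold_locales
    fix V W :: "'a monoid set"
    assume "V \<in> carrier MON" "W \<in> carrier MON"
    then have "monoid_variety V" "monoid_variety W" by (simp_all add: MON_def)
    then show "\<exists>s. least MON s (Upper MON {V, W})" "\<exists>s. greatest MON s (Lower MON {V, W})"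
      using least_Upper_MON greatest_Lower_MON by blast+
  qed
qed

lemma meet_MON:
  assumes "monoid_variety V" "monoid_variety W"
  shows "V \<sqinter>\<^bsub>MON\<^esub> W = V \<inter> W"
proof -
  interpret lattice MON by (rule lattice_MON)
  show ?thesis unfolding meet_def inf_def
    using greatest_unique[OF _ greatest_Lower_MON[OF assms]] greatest_Lower_MON[OF assms] 
    by (metis (mono_tags) someI)
qed

lemma join_MON:
  assumes "monoid_variety V" "monoid_variety W"
  shows "V \<squnion>\<^bsub>MON\<^esub> W = \<Inter>{U. monoid_variety U \<and> V \<union> W \<subseteq> U}"
proof -
  interpret lattice MON by (rule lattice_MON)
  show ?thesis unfolding join_def sup_def
    using least_unique[OF _ least_Upper_MON[OF assms]] least_Upper_MON[OF assms] 
    by (metis (mono_tags) someI)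
qed

lemma eval_word_closed:
  assumes "monoid M" "\<phi> \<in> UNIV \<rightarrow> carrier M"
  shows "eval_word M \<phi> w \<in> carrier M"
proof -
  interpret monoid M by fact
  show ?thesis using assms(2) by (induction w) (auto simp: eval_word_def Pi_iff)
qed

lemma eval_word_append:
  assumes "monoid M" "\<phi> \<in> UNIV \<rightarrow> carrier M"
  shows "eval_word M \<phi> (u @ v) = eval_word M \<phi> u \<otimes>\<^bsub>M\<^esub> eval_word M \<phi> v"
proof -
  interpret monoid M by fact
  have c: "eval_word M \<phi> w \<in> carrier M" for w by (rule eval_word_closed[OF assms])
  show ?thesis
  proof (induction u)
    case Nil
    then show ?case using c[of v] by (simp add: eval_word_def)
  next
    case (Cons x u)
    have "\<phi> x \<in> carrier M" using assms(2) by auto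
    then show ?case using Cons c[of u] c[of v] by (simp add: eval_word_def m_assoc)
  qed
qed

lemma models_of_subset_any_type:
  fixes N :: "('b, 'c) monoid_scheme"
  assumes sub: "models_of \<Sigma> \<subseteq> (models_of \<Sigma>' :: ('a::infinite) monoid set)"
    and N: "monoid N" and holds: "\<And>u v. (u, v) \<in> \<Sigma> \<Longrightarrow> holds_in N u v"
    and uv: "(u, v) \<in> \<Sigma>'"
  shows "holds_in N u v"
  unfolding holds_in_def
proof
  fix \<phi> :: "nat \<Rightarrow> 'b" assume \<phi>: "\<phi> \<in> UNIV \<rightarrow> carrier N"
  interpret N: monoid N by fact
  define C where "C = range (eval_word N \<phi>)"
  have CN: "C \<subseteq> carrier N" unfolding C_def using eval_word_closed[OF N \<phi>] by auto
  have Cm: "a \<otimes>\<^bsub>N\<^esub> b \<in> C" if "a \<in> C" "b \<in> C" for a b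
    using that unfolding C_def by (auto simp: eval_word_append[OF N \<phi>, symmetric])
  have C1: "\<one>\<^bsub>N\<^esub> \<in> C"
    unfolding C_def by (rule range_eqI[of _ _ "[]"]) (simp add: eval_word_def)
  have C\<phi>: "\<phi> x \<in> C" for x
    unfolding C_def using \<phi> by (intro range_eqI[of _ _ "[x]"]) (auto simp: eval_word_def Pi_iff)
  obtain e :: "nat \<Rightarrow> 'a" where e: "inj e"
    using infinite_UNIV infinite_countable_subset by blast
  have "countable C" unfolding C_def by simp
  then have "inj_on (e \<circ> to_nat_on C) C"
    using e by (intro comp_inj_on inj_on_to_nat_on) (auto intro: inj_on_subset)
  then obtain f :: "'b \<Rightarrow> 'a" where f: "inj_on f C" by blast
  define g where "g = inv_into C f"
  have gf: "g (f c) = c" if "c \<in> C" for c using f that by (simp add: g_def)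
  define M :: "'a monoid" where
    "M = \<lparr>carrier = f ` C, mult = (\<lambda>a b. f (g a \<otimes>\<^bsub>N\<^esub> g b)), one = f \<one>\<^bsub>N\<^esub>\<rparr>"
  have M: "monoid M"
    by unfold_locales (use CN in \<open>auto simp: M_def gf Cm C1 subset_iff N.m_assoc\<close>)
  have ev: "g (eval_word M \<psi> w) = eval_word N (g \<circ> \<psi>) w \<and> eval_word M \<psi> w \<in> f ` C"
    if \<psi>: "\<psi> \<in> UNIV \<rightarrow> f ` C" for w and \<psi> :: "nat \<Rightarrow> 'a"
  proof (induction w)
    case Nil
    show ?case by (simp add: eval_word_def M_def gf C1)
  next
    case (Cons x w)
    obtain c d where "c \<in> C" "\<psi> x = f c" "d \<in> C" "eval_word M \<psi> w = f d"
      using \<psi> Cons by blast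
    then show ?case using Cons by (auto simp: eval_word_def M_def gf Cm)
  qed
  have "holds_in M s t" if "(s, t) \<in> \<Sigma>" for s t
    unfolding holds_in_def
  proof
    fix \<psi> :: "nat \<Rightarrow> 'a" assume "\<psi> \<in> UNIV \<rightarrow> carrier M"
    then have \<psi>: "\<psi> \<in> UNIV \<rightarrow> f ` C" by (simp add: M_def)
    have "g (\<psi> x) \<in> carrier N" for x
    proof -
      obtain c where "c \<in> C" "\<psi> x = f c" using \<psi> by blast
      then show ?thesis using CN gf by auto
    qed
    then have "g \<circ> \<psi> \<in> UNIV \<rightarrow> carrier N" by simp
    then have "eval_word N (g \<circ> \<psi>) s = eval_word N (g \<circ> \<psi>) t"
      using holds[OF that] by (auto simp: holds_in_def)
    then have "g (eval_word M \<psi> s) = g (eval_word M \<psi> t)" using ev[OF \<psi>] by simp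
    then show "eval_word M \<psi> s = eval_word M \<psi> t"
      using ev[OF \<psi>, of s] ev[OF \<psi>, of t] gf by auto
  qed
  then have "M \<in> models_of \<Sigma>" using M by (auto simp: models_of_def all_monoids_def)
  then have "holds_in M u v" using sub uv by (auto simp: models_of_def)
  moreover have f\<phi>: "f \<circ> \<phi> \<in> UNIV \<rightarrow> f ` C" using C\<phi> by auto
  ultimately have "eval_word M (f \<circ> \<phi>) u = eval_word M (f \<circ> \<phi>) v"
    by (auto simp: holds_in_def M_def)
  moreover have "g \<circ> (f \<circ> \<phi>) = \<phi>" using C\<phi> gf by auto
  ultimately show "eval_word N \<phi> u = eval_word N \<phi> v"
    using ev[OF f\<phi>] by metis
qed

end

theory Submission
  imports Defs "HOL-Library.Sublist"
begin

text \<open>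
  Monoid varieties correspond to fully invariant congruences on the free monoid, with the order
  reversed. Modularity of \<open>V\<close> enters through one principle, \<open>modular_separation\<close>: suppose
  that \<open>V\<close> satisfies \<open>p \<approx> p'\<close> and \<open>q \<approx> q'\<close>, that some fully invariant congruence relates \<open>p\<close>
  to \<open>q\<close> and neither of them to any third word, and that another one relates \<open>p'\<close> to \<open>q'\<close> while it isolates both
  \<open>p\<close> and \<open>q\<close>. Then \<open>V\<close> satisfies \<open>p \<approx> q\<close>. The two conditions are combinatorial: they ask how
  images of \<open>p\<close>, \<open>q\<close>, \<open>p'\<close>, \<open>q'\<close> under substitutions, possibly erasing letters, occur as factors
  of \<open>p\<close> and \<open>q\<close>. In all applications \<open>p\<close> and \<open>q\<close> surround a common word \<open>u\<close> with two different
  frames, \<open>p'\<close> and \<open>q'\<close> arise by replacing \<open>u\<close> with \<open>v\<close> for an identity \<open>u \<approx> v\<close> of \<open>V\<close>, and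
  \<open>p \<approx> q\<close> transfers the information to the letters of the frames. A substitution that erases the
  frame letters causes no harm, since it makes \<open>p\<close> and \<open>q\<close> equal; the frames are chosen so
  rigid that hardly anything else fits.

  The principle is applied four times, each time with the identity won before.
  \<^item> A proper variety has a nontrivial identity. Frames made of powers of one letter show that the
    identities of \<open>V\<close> are not all balanced, so \<open>x\<^sup>k \<approx> x\<^sup>n\<close> for some \<open>k < n\<close> (\<open>power_frame\<close>,
    \<open>distinct_powers\<close>).
  \<^item> The words \<open>abc x\<^sup>k acb\<close> and \<open>bca x\<^sup>k cba\<close> give \<open>abcacb \<approx> bcacba\<close> (\<open>commuting_word\<close>).
    This passes from words with high powers, which are all that \<open>x\<^sup>k \<approx> x\<^sup>n\<close> can change, to
    square-free words.
  \<^item> A square-free word with a nontrivial identity can be framed such that \<open>p\<close> and \<open>q\<close> stay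
    square-free although one frame letter occurs twice in \<open>p\<close> and three times in \<open>q\<close>. This gives
    \<open>x\<^sup>2 \<approx> x\<^sup>3\<close> (\<open>squares_idempotent\<close>).
  \<^item> The words \<open>x\<^sup>2 y\<close> and \<open>y x\<^sup>2\<close> give the second identity (\<open>squares_central\<close>).
\<close>

section \<open>Substitutions and fully invariant congruences\<close>

definition subst :: "(nat \<Rightarrow> word) \<Rightarrow> word \<Rightarrow> word" where
  "subst \<phi> w = concat (map \<phi> w)"

lemma subst_simps [simp]:
  "subst \<phi> [] = []" "subst \<phi> (x # w) = \<phi> x @ subst \<phi> w" "subst \<phi> (u @ v) = subst \<phi> u @ subst \<phi> v"
  by (simp_all add: subst_def)

lemma subst_subst: "subst \<psi> (subst \<phi> w) = subst (\<lambda>x. subst \<psi> (\<phi> x)) w"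
  by (induction w) auto

lemma subst_cong: "(\<And>x. x \<in> set w \<Longrightarrow> \<phi> x = \<psi> x) \<Longrightarrow> subst \<phi> w = subst \<psi> w"
  by (induction w) auto

lemma subst_singletons [simp]: "subst (\<lambda>x. [x]) w = w"
  by (induction w) auto

lemma subst_replicate: "subst \<phi> (replicate n x) = concat (replicate n (\<phi> x))"
  by (simp add: subst_def)

lemma eval_word_subst:
  assumes "monoid M" "\<psi> \<in> UNIV \<rightarrow> carrier M"
  shows "eval_word M \<psi> (subst \<phi> w) = eval_word M (\<lambda>x. eval_word M \<psi> (\<phi> x)) w"
  using assms by (induction w) (simp_all add: eval_word_append, simp_all add: eval_word_def)

lemma holds_in_context_subst:
  fixes M :: "('a, 'b) monoid_scheme"
  assumes "monoid M" "holds_in M u v"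
  shows "holds_in M (c @ subst \<phi> u @ d) (c @ subst \<phi> v @ d)"
  unfolding holds_in_def
proof
  fix \<psi> :: "nat \<Rightarrow> 'a" assume \<psi>: "\<psi> \<in> UNIV \<rightarrow> carrier M"
  have "eval_word M (\<lambda>x. eval_word M \<psi> (\<phi> x)) u = eval_word M (\<lambda>x. eval_word M \<psi> (\<phi> x)) v"
    using assms(2) eval_word_closed[OF assms(1) \<psi>] by (auto simp: holds_in_def)
  then show "eval_word M \<psi> (c @ subst \<phi> u @ d) = eval_word M \<psi> (c @ subst \<phi> v @ d)"
    by (simp add: eval_word_append[OF assms(1) \<psi>] eval_word_subst[OF assms(1) \<psi>])
qed

lemma satisfies_identity_context_subst:
  assumes "V \<subseteq> all_monoids" "satisfies_identity V u v"
  shows "satisfies_identity V (c @ subst \<phi> u @ d) (c @ subst \<phi> v @ d)"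
  using assms holds_in_context_subst by (fastforce simp: satisfies_identity_def all_monoids_def)

lemma satisfies_identity_context:
  assumes "V \<subseteq> all_monoids" "satisfies_identity V u v"
  shows "satisfies_identity V (c @ u @ d) (c @ v @ d)"
  using satisfies_identity_context_subst[OF assms, of c "\<lambda>x. [x]"] by simp

lemma satisfies_identity_subst:
  assumes "V \<subseteq> all_monoids" "satisfies_identity V u v"
  shows "satisfies_identity V (subst \<phi> u) (subst \<phi> v)"
  using satisfies_identity_context_subst[OF assms, of "[]" \<phi> "[]"] by simp

lemma satisfies_identity_sym: "satisfies_identity V u v \<Longrightarrow> satisfies_identity V v u"
  by (simp add: satisfies_identity_def holds_in_def)

text \<open>
  The largest fully invariant congruence on which \<open>f\<close> is constant, that is, the equational theory of
  the largest variety none of whose identities relates two words with different values of \<open>f\<close>.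
\<close>

definition invariant_core :: "(word \<Rightarrow> 'c) \<Rightarrow> (word \<times> word) set" where
  "invariant_core f = {(s, t). \<forall>c \<phi> d. f (c @ subst \<phi> s @ d) = f (c @ subst \<phi> t @ d)}"

lemma invariant_coreD:
  "(s, t) \<in> invariant_core f \<Longrightarrow> f (c @ subst \<phi> s @ d) = f (c @ subst \<phi> t @ d)"
  by (simp add: invariant_core_def)

lemma invariant_core_kernel: "(s, t) \<in> invariant_core f \<Longrightarrow> f s = f t"
  using invariant_coreD[of s t f "[]" "\<lambda>x. [x]" "[]"] by simp

lemma invariant_core_refl: "(s, s) \<in> invariant_core f"
  by (simp add: invariant_core_def)

lemma invariant_core_sym: "(s, t) \<in> invariant_core f \<Longrightarrow> (t, s) \<in> invariant_core f"
  by (simp add: invariant_core_def)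

lemma invariant_core_trans:
  "(s, t) \<in> invariant_core f \<Longrightarrow> (t, u) \<in> invariant_core f \<Longrightarrow> (s, u) \<in> invariant_core f"
  by (simp add: invariant_core_def)

lemma invariant_core_context_subst:
  assumes "(s, t) \<in> invariant_core f"
  shows "(c @ subst \<phi> s @ d, c @ subst \<phi> t @ d) \<in> invariant_core f"
  unfolding invariant_core_def
proof clarify
  fix c' \<psi> d'
  show "f (c' @ subst \<psi> (c @ subst \<phi> s @ d) @ d') = f (c' @ subst \<psi> (c @ subst \<phi> t @ d) @ d')"
    using invariant_coreD[OF assms, of "c' @ subst \<psi> c" "\<lambda>x. subst \<psi> (\<phi> x)" "subst \<psi> d @ d'"]
    by (simp add: subst_subst)
qed

text \<open>
  This is Birkhoff's completeness theorem for the theories in use here: the quotient of the free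
  monoid by the congruence is a model that violates every identity outside it. Its elements are
  coded by chosen representatives \<open>rep w\<close> of the classes, so the quotient is a monoid of words.
\<close>

lemma invariant_core_complete:
  assumes sub: "models_of (invariant_core f) \<subseteq> (models_of {(s, t)} :: ('a::infinite) monoid set)"
  shows "(s, t) \<in> invariant_core f"
proof -
  let ?R = "invariant_core f"
  define rep where "rep w = (SOME v. (w, v) \<in> ?R)" for w
  have rep: "(w, rep w) \<in> ?R" for w
    unfolding rep_def by (rule someI[of _ w]) (rule invariant_core_refl)
  have rep_eqI: "rep u = rep v" if "(u, v) \<in> ?R" for u v
  proof -
    have "(u, w) \<in> ?R \<longleftrightarrow> (v, w) \<in> ?R" for w
      using that invariant_core_trans invariant_core_sym by blast
    then show ?thesis by (simp add: rep_def)
  qed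
  have rep_eqD: "(u, v) \<in> ?R" if "rep u = rep v" for u v
    using that rep[of u] rep[of v] invariant_core_trans invariant_core_sym by metis
  have rep_app: "rep (c @ rep w @ d) = rep (c @ w @ d)" for c w d
    using invariant_core_context_subst[OF rep, of c "\<lambda>x. [x]" w d] rep_eqI by simp
  have rep_app1: "rep (rep w @ d) = rep (w @ d)" and rep_app2: "rep (c @ rep w) = rep (c @ w)" 
    for c w d using rep_app[of "[]" w d] rep_app[of c w "[]"] by simp_all
  have rep_rep: "rep (rep w) = rep w" for w using rep_app[of "[]" w "[]"] by simp
  define N :: "word monoid" where
    "N = \<lparr>carrier = range rep, mult = (\<lambda>u v. rep (u @ v)), one = rep []\<rparr>"
  have N: "monoid N"
    by unfold_locales (auto simp: N_def rep_app1 rep_app2 rep_rep)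
  have ev: "eval_word N \<phi> w = rep (subst \<phi> w)" for \<phi> w
    by (induction w) (simp_all add: eval_word_def N_def rep_app2)
  have "holds_in N u v" if "(u, v) \<in> ?R" for u v
    using that invariant_core_context_subst[OF that, of "[]" _ "[]"] rep_eqI
    by (auto simp: holds_in_def ev)
  then have "holds_in N s t"
    using models_of_subset_any_type[OF sub N] by blast
  then have "eval_word N (\<lambda>x. rep [x]) s = eval_word N (\<lambda>x. rep [x]) t"
    by (auto simp: holds_in_def N_def)
  moreover have "rep (subst (\<lambda>x. rep [x]) w) = rep w" for w
  proof (induction w)
    case (Cons x w)
    have "rep (rep [x] @ subst (\<lambda>x. rep [x]) w) = rep ([x] @ rep (subst (\<lambda>x. rep [x]) w))"
      by (simp only: rep_app1 rep_app2)
    also have "\<dots> = rep (x # w)"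
      by (simp only: Cons rep_app2) simp
    finally show ?case by simp
  qed simp
  ultimately show ?thesis using rep_eqD by (simp add: ev)
qed

section \<open>What modularity forces\<close>

lemma modular_element_MON_subset: "modular_element MON V \<Longrightarrow> V \<subseteq> all_monoids"
  using monoid_variety_subset by (auto simp: modular_element_def MON_def)

text \<open>
  The only use of modularity. Let \<open>Y\<close> and \<open>Z\<close> be the varieties of the two cores in the hypotheses;
  then \<open>Y \<subseteq> Z\<close>. The identity \<open>p \<approx> q\<close> holds in \<open>Y\<close>, and in \<open>V \<inter> Z\<close> by the chain
  \<open>p \<approx> p' \<approx> q' \<approx> q\<close>, hence in \<open>(V \<and> Z) \<or> Y\<close>, which is \<open>(V \<or> Y) \<and> Z\<close>. If \<open>V\<close> failed \<open>p \<approx> q\<close>, an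
  identity common to \<open>V\<close> and \<open>Y\<close> could relate \<open>p\<close> to nothing but itself: the theory of \<open>Y\<close> offers
  only \<open>q\<close> as a partner. The same holds for \<open>q\<close>, so all these identities belong to the theory
  of \<open>Z\<close>. Then \<open>Z \<subseteq> V \<or> Y\<close> and \<open>Z\<close> satisfies \<open>p \<approx> q\<close>, although its theory isolates \<open>p\<close>.
\<close>

lemma modular_separation:
  fixes V :: "('a::infinite) monoid set"
  assumes V: "modular_element MON V"
    and p: "satisfies_identity V p p'" and q: "satisfies_identity V q q'"
    and pq: "(p, q) \<in> invariant_core (\<lambda>w. w \<in> {p, q})"
    and pq': "(p', q') \<in> invariant_core (\<lambda>w. (w = p, w = q))"
  shows "satisfies_identity V p q"
proof (rule ccontr)
  assume n: "\<not> satisfies_identity V p q"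
  then have "p \<noteq> q" by (auto simp: satisfies_identity_def holds_in_def)
  let ?B = "invariant_core (\<lambda>w. w \<in> {p, q})" and ?C = "invariant_core (\<lambda>w. (w = p, w = q))"
  let ?Y = "models_of ?B :: 'a monoid set" and ?Z = "models_of ?C :: 'a monoid set"
  have "(s, t) \<in> ?B" if "(s, t) \<in> ?C" for s t
    using that by (simp add: invariant_core_def)
  then have YZ: "?Y \<subseteq> ?Z" by (fastforce simp: models_of_def)
  have varV: "monoid_variety V" using V by (simp add: modular_element_def MON_def)
  then have Vm: "V \<subseteq> all_monoids" by (rule monoid_variety_subset)
  have varY: "monoid_variety ?Y" and varZ: "monoid_variety ?Z" by (auto simp: monoid_variety_def)
  have "(V \<inter> ?Z) \<squnion>\<^bsub>MON\<^esub> ?Y = (V \<squnion>\<^bsub>MON\<^esub> ?Y) \<inter> ?Z"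
  proof -
    have "(V \<sqinter>\<^bsub>MON\<^esub> ?Z) \<squnion>\<^bsub>MON\<^esub> ?Y = (V \<squnion>\<^bsub>MON\<^esub> ?Y) \<sqinter>\<^bsub>MON\<^esub> ?Z"
      using V varY varZ YZ by (simp add: modular_element_def MON_def)
    moreover have "monoid_variety (V \<squnion>\<^bsub>MON\<^esub> ?Y)"
    proof -
      let ?A = "{U. monoid_variety U \<and> V \<union> ?Y \<subseteq> U}"
      have "V \<squnion>\<^bsub>MON\<^esub> ?Y = all_monoids \<inter> \<Inter>?A"
        using join_MON[OF varV varY] monoid_variety_all_monoids Vm
          monoid_variety_subset[OF varY] by auto
      moreover have "monoid_variety (all_monoids \<inter> \<Inter>?A)" by (rule monoid_variety_Inter) simp
      ultimately show ?thesis by simp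
    qed
    ultimately show ?thesis by (simp only: meet_MON varV varZ)
  qed
  moreover have "(V \<inter> ?Z) \<squnion>\<^bsub>MON\<^esub> ?Y \<subseteq> models_of {(p, q)}"
  proof -
    have "holds_in M p q" if M: "M \<in> V" "M \<in> ?Z" for M
    proof -
      have "holds_in M p p'" "holds_in M q q'" using p q M by (auto simp: satisfies_identity_def)
      moreover have "holds_in M p' q'" using M(2) pq' by (auto simp: models_of_def)
      ultimately show ?thesis by (simp add: holds_in_def)
    qed
    moreover have "holds_in M p q" if "M \<in> ?Y" for M
      using that pq by (auto simp: models_of_def)
    moreover have "monoid_variety (models_of {(p, q)} :: 'a monoid set)"
      by (auto simp: monoid_variety_def)
    ultimately show ?thesis
      using Vm monoid_variety_subset[OF varY]
      unfolding join_MON[OF monoid_variety_Int[OF varV varZ] varY]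
      by (intro Inter_lower) (auto simp: models_of_def)
  qed
  moreover have "?Z \<subseteq> V \<squnion>\<^bsub>MON\<^esub> ?Y"
  proof -
    have sC: "(s, t) \<in> ?C" if a: "satisfies_identity V s t" and b: "(s, t) \<in> ?B" for s t
    proof -
      have "(s' = p \<longleftrightarrow> t' = p) \<and> (s' = q \<longleftrightarrow> t' = q)"
        if s': "s' = c @ subst \<phi> s @ d" and t': "t' = c @ subst \<phi> t @ d" for s' t' c \<phi> d
      proof -
        have "satisfies_identity V s' t'"
          unfolding s' t' by (rule satisfies_identity_context_subst[OF Vm a])
        moreover have "s' \<in> {p, q} \<longleftrightarrow> t' \<in> {p, q}"
          unfolding s' t' using invariant_coreD[OF b] .
        ultimately show ?thesis using n satisfies_identity_sym[of V q p] by blast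
      qed
      then show ?thesis by (simp add: invariant_core_def)
    qed
    have "?Z \<subseteq> U" if U: "monoid_variety U" "V \<subseteq> U" "?Y \<subseteq> U" for U
    proof -
      obtain \<Sigma> where \<Sigma>: "U = models_of \<Sigma>" using U(1) by (auto simp: monoid_variety_def)
      have "(s, t) \<in> ?C" if st: "(s, t) \<in> \<Sigma>" for s t
      proof (rule sC)
        show "satisfies_identity V s t"
          using U(2) st by (auto simp: \<Sigma> satisfies_identity_def models_of_def)
        have "?Y \<subseteq> models_of {(s, t)}" using U(3) st by (auto simp: \<Sigma> models_of_def)
        then show "(s, t) \<in> ?B" by (rule invariant_core_complete)
      qed
      then show ?thesis unfolding \<Sigma> models_of_def by blast
    qed
    then show ?thesis unfolding join_MON[OF varV varY] by auto
  qed
  ultimately have "?Z \<subseteq> models_of {(p, q)}" by auto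
  then have "(p, q) \<in> ?C" by (rule invariant_core_complete)
  from invariant_core_kernel[OF this] show False using \<open>p \<noteq> q\<close> by simp
qed

section \<open>Proper modular varieties are periodic\<close>

lemma count_list_replicate: "count_list (replicate n x) x = n"
  by (induction n) auto

text \<open>A run of \<open>a\<close> cannot overlap \<open>u\<close>, so it stays on one side of it.\<close>

lemma run_in_frame:
  assumes eq: "c @ replicate s a @ d = replicate i a @ u @ replicate j a"
    and u: "a \<notin> set u" "u \<noteq> []" and s: "0 < s"
  shows "length c + s \<le> i \<or> s + length d \<le> j"
proof (rule ccontr)
  assume n: "\<not> ?thesis"
  have "length c + s + length d = i + length u + j" using arg_cong[OF eq, of length] by simp
  then have b: "i < length c + s" "length c < i + length u" using n by simp_all
  define m where "m = max (length c) i"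
  have m: "length c \<le> m" "m < length c + s" "i \<le> m" "m < i + length u"
    using b s u(2) by (auto simp: m_def)
  have "(c @ replicate s a @ d) ! m = a"
  proof -
    have "m - length c < s" using m by linarith
    then show ?thesis using m by (simp add: nth_append)
  qed
  moreover have "(replicate i a @ u @ replicate j a) ! m = u ! (m - i)" and "u ! (m - i) \<in> set u"
  proof -
    have "m - i < length u" using m by linarith
    then show "(replicate i a @ u @ replicate j a) ! m = u ! (m - i)" "u ! (m - i) \<in> set u"
      using m by (simp_all add: nth_append)
  qed
  ultimately show False using eq u by metis
qed

text \<open>
  Frames \<open>a\<^sup>i _ a\<^sup>j\<close> with exponents \<open>(r, r + 2)\<close> or \<open>(r + 1, r)\<close> are rigid. The image \<open>e\<close> of \<open>a\<close> occurs
  at least \<open>2 r + 1\<close> times, while \<open>u\<close> is too short to contain any letter \<open>r\<close> times; so \<open>e\<close> is a power of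
  \<open>a\<close>. Neither side of a framed \<open>u\<close> has room for both runs, so they lie on different sides; as
  neither pair of exponents dominates the other, the two frames coincide.
\<close>

lemma power_frame_occurrence:
  assumes eq: "c @ concat (replicate i e) @ y @ concat (replicate j e) @ d = replicate i0 a @ u @ replicate j0 a"
    and e: "e \<noteq> []" and u: "a \<notin> set u" "u \<noteq> []" "length u < r" and r: "2 \<le> r"
    and ij: "(i, j) \<in> {(r, r + 2), (r + 1, r)}" "(i0, j0) \<in> {(r, r + 2), (r + 1, r)}"
  shows "e = [a] \<and> i = i0 \<and> j = j0 \<and> c = [] \<and> d = [] \<and> y = u"
proof -
  have cnt: "count_list (concat (replicate m e)) z = m * count_list e z" for m z
    by (induction m) auto
  have "z = a" if "z \<in> set e" for z
  proof (rule ccontr)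
    assume "z \<noteq> a"
    then have "count_list (replicate i0 a @ u @ replicate j0 a) z = count_list u z"
      by (simp add: count_list_0_iff)
    also have "\<dots> < r" using count_le_length[of u z] u(3) by linarith
    finally have "i * count_list e z < r" by (simp add: eq[symmetric] cnt)
    moreover have "count_list e z \<noteq> 0" using that by (simp add: count_list_0_iff)
    then have "i \<le> i * count_list e z" by simp
    ultimately have "i < r" by linarith
    then show False using ij by auto
  qed
  then have ea: "e = replicate (length e) a" by (metis replicate_eqI)
  define m where "m = length e"
  have m: "1 \<le> m" using e by (simp add: m_def Suc_le_eq)
  have em: "e = replicate m a" using ea by (simp add: m_def)
  have pow: "concat (replicate l e) = replicate (l * m) a" for l
    unfolding em by (induction l) (auto simp: replicate_add)
  have im: "i \<le> i * m" "j \<le> j * m" using m by simp_all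
  have large: "i0 < i + j" "j0 < i + j" and pos: "0 < i" "0 < j" using ij r by auto
  then have pos': "0 < i * m" "0 < j * m" using im by linarith+
  have first: "length c + i * m \<le> i0"
  proof -
    have "c @ replicate (i * m) a @ (y @ replicate (j * m) a @ d) = replicate i0 a @ u @ replicate j0 a"
      using eq by (simp add: pow)
    from run_in_frame[OF this u(1,2) pos'(1)] show ?thesis using im large by simp
  qed
  have second: "j * m + length d \<le> j0"
  proof -
    have "(c @ replicate (i * m) a @ y) @ replicate (j * m) a @ d = replicate i0 a @ u @ replicate j0 a"
      using eq by (simp add: pow)
    from run_in_frame[OF this u(1,2) pos'(2)] show ?thesis using im large by simp
  qed
  have "i \<le> i0" "j \<le> j0" using first second im by linarith+
  then have ij0: "i = i0" "j = j0" using ij by auto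
  have "length c = 0" "length d = 0" and ijm: "i * m = i" "j * m = j"
    using first second im ij0 by linarith+
  then have cd: "c = []" "d = []" by simp_all
  have "m = 1" using ijm(1) pos(1) by simp
  then show ?thesis using eq cd ij0 em by (simp add: pow)
qed

text \<open>
  Separation applied to \<open>p = a\<^sup>r u a\<^sup>r\<^sup>+\<^sup>2\<close> and \<open>q = a\<^sup>r\<^sup>+\<^sup>1 u a\<^sup>r\<close>, with \<open>v\<close> in place of \<open>u\<close> in \<open>p'\<close> and \<open>q'\<close>. A
  substitution that erases \<open>a\<close> does not see the difference between the two frames. Any other one
  fixes \<open>a\<close> and sends the core of the frame to \<open>u\<close>, which is impossible for \<open>v\<close>. Erasing \<open>u\<close> from
  \<open>p \<approx> q\<close> leaves two different powers of \<open>a\<close>.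
\<close>

lemma power_frame:
  fixes V :: "('a::infinite) monoid set"
  assumes V: "modular_element MON V" and uv: "satisfies_identity V u v"
    and u: "a \<notin> set u" "u \<noteq> []" "length u < r" and r: "2 \<le> r"
    and no: "\<And>\<phi>. subst \<phi> v \<noteq> u"
  shows "satisfies_identity V (replicate (2 * r + 2) a) (replicate (2 * r + 1) a)"
proof -
  have Vm: "V \<subseteq> all_monoids" using V by (rule modular_element_MON_subset)
  define w where "w y = (\<lambda>(i, j). replicate i a @ y @ replicate j a)" for y and ij :: "nat \<times> nat"
  let ?I = "{(r, r + 2), (r + 1, r)}"
  let ?p = "w u (r, r + 2)" and ?q = "w u (r + 1, r)"
  let ?p' = "w v (r, r + 2)" and ?q' = "w v (r + 1, r)"
  have erased: "subst \<phi> (w y ij) = subst \<phi> y" if "\<phi> a = []" for \<phi> y ij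
    using that by (cases ij) (simp add: w_def subst_replicate)
  have occ: "\<phi> a = [a] \<and> c = [] \<and> d = [] \<and> subst \<phi> y = u"
    if "c @ subst \<phi> (w y ij) @ d \<in> {?p, ?q}" "\<phi> a \<noteq> []" "ij \<in> ?I" for c \<phi> d y ij
  proof -
    obtain i j where ij: "ij = (i, j)" by (cases ij)
    have "\<exists>kl \<in> ?I. c @ subst \<phi> (w y ij) @ d = w u kl" using that(1) by blast
    then obtain i0 j0 where ij0: "(i0, j0) \<in> ?I" "c @ subst \<phi> (w y ij) @ d = w u (i0, j0)"
      by (metis surj_pair)
    show ?thesis
      using power_frame_occurrence[OF _ that(2) u r that(3)[unfolded ij] ij0(1), of c "subst \<phi> y" d] ij0(2)
      by (simp add: w_def ij subst_replicate)
  qed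
  have "satisfies_identity V ?p ?q"
  proof (rule modular_separation[OF V])
    show "satisfies_identity V ?p ?p'" "satisfies_identity V ?q ?q'"
      unfolding w_def prod.case by (rule satisfies_identity_context[OF Vm uv])+
    have T: "c @ subst \<phi> (w u kl) @ d \<in> {?p, ?q}"
      if "c @ subst \<phi> (w u ij) @ d \<in> {?p, ?q}" "ij \<in> ?I" "kl \<in> ?I" for c \<phi> d ij kl
    proof (cases "\<phi> a = []")
      case True
      then show ?thesis using that(1) by (simp add: erased)
    next
      case False
      from occ[OF that(1) this that(2)] have "c @ subst \<phi> (w u kl) @ d = w u kl"
        by (cases kl) (simp add: w_def subst_replicate)
      then show ?thesis using that(3) by auto
    qed
    have "c @ subst \<phi> ?p @ d \<in> {?p, ?q} \<longleftrightarrow> c @ subst \<phi> ?q @ d \<in> {?p, ?q}" for c \<phi> d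
      using T[of c \<phi> "(r, r + 2)" d "(r + 1, r)"] T[of c \<phi> "(r + 1, r)" d "(r, r + 2)"] by blast
    then show "(?p, ?q) \<in> invariant_core (\<lambda>y. y \<in> {?p, ?q})"
      unfolding invariant_core_def by blast
    have "(c @ subst \<phi> ?p' @ d = ?p \<longleftrightarrow> c @ subst \<phi> ?q' @ d = ?p) \<and>
        (c @ subst \<phi> ?p' @ d = ?q \<longleftrightarrow> c @ subst \<phi> ?q' @ d = ?q)" for c \<phi> d
    proof (cases "\<phi> a = []")
      case True
      then show ?thesis by (simp add: erased)
    next
      case False
      have "c @ subst \<phi> (w v ij) @ d \<notin> {?p, ?q}" if ij: "ij \<in> ?I" for ij
      proof
        assume "c @ subst \<phi> (w v ij) @ d \<in> {?p, ?q}"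
        from occ[OF this False ij] show False using no by blast
      qed
      then show ?thesis by blast
    qed
    then show "(?p', ?q') \<in> invariant_core (\<lambda>y. (y = ?p, y = ?q))"
      unfolding invariant_core_def by blast
  qed
  have erase_u: "subst (\<lambda>x. if x = a then [a] else []) u = []"
    using u(1) by (induction u) auto
  from satisfies_identity_subst[OF Vm \<open>satisfies_identity V ?p ?q\<close>, of "\<lambda>x. if x = a then [a] else []"]
  have "satisfies_identity V (replicate r a @ replicate (r + 2) a) (replicate (r + 1) a @ replicate r a)"
    by (simp add: w_def subst_replicate erase_u)
  then show ?thesis by (simp only: replicate_add[symmetric]) (simp add: mult_2)
qed

definition projection :: "nat \<Rightarrow> nat \<Rightarrow> nat \<Rightarrow> word" where
  "projection x y z = (if z = x then [0] else if z = y then [1] else [])"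

text \<open>
  At the first position where \<open>u\<close> and \<open>v\<close> differ, two letters compete; keeping only these two
  preserves the difference. Equal letter counts exclude that one word is a prefix of the other.
\<close>

lemma distinguishing_projection:
  assumes "u \<noteq> v" "\<And>x. count_list u x = count_list v x"
  shows "\<exists>x y. subst (projection x y) u \<noteq> subst (projection x y) v"
  using assms
proof (induction u arbitrary: v)
  case Nil
  then have "set v = {}" by (metis count_list.simps(1) count_list_0_iff ex_in_conv)
  then show ?case using Nil by simp
next
  case (Cons a u)
  have "count_list v a \<noteq> 0" using Cons.prems(2)[of a] by simp
  then obtain b v' where v: "v = b # v'" by (cases v) auto
  show ?case
  proof (cases "a = b")
    case True
    have "count_list u x = count_list v' x" for x
      using Cons.prems(2)[of x] by (simp add: v True split: if_splits)
    with Cons.IH[of v'] Cons.prems(1) obtain x y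
      where "subst (projection x y) u \<noteq> subst (projection x y) v'" by (auto simp: v True)
    then have "subst (projection x y) (a # u) \<noteq> subst (projection x y) v" by (simp add: v True)
    then show ?thesis by blast
  next
    case False
    then have "subst (projection a b) (a # u) \<noteq> subst (projection a b) v"
      by (simp add: v projection_def)
    then show ?thesis by blast
  qed
qed

lemma length_subst_binary:
  assumes "set v \<subseteq> {0, 1}"
  shows "length (subst \<phi> v) = count_list v 0 * length (\<phi> 0) + count_list v 1 * length (\<phi> 1)"
  using assms by (induction v) auto

text \<open>
  The lemma on power frames needs a \<open>v\<close> without \<open>u\<close> among its images. Long powers of the two letters
  at the ends achieve this: comparing lengths, either both letters have images of length one,
  which the ends determine, or one letter is erased and the image of the other is no longer than the
  ends, hence a power of one letter, which cannot produce both ends.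
\<close>

lemma subst_pinned:
  fixes u v :: word
  assumes v: "set v \<subseteq> {0, 1}" and len: "length v = length u" and uv: "u \<noteq> v"
    and N: "length u < N" "2 \<le> N"
  shows "subst \<phi> (replicate N 0 @ v @ replicate N 1) \<noteq> replicate N 0 @ u @ replicate N 1"
proof
  let ?w = "replicate N 0 @ u @ replicate N (1::nat)"
  assume eq: "subst \<phi> (replicate N 0 @ v @ replicate N 1) = ?w"
  define s t i j where "s = \<phi> 0" and "t = \<phi> 1" and "i = count_list v 0" and "j = count_list v 1"
  obtain N' where N': "N = Suc N'" using N by (cases N) auto
  have "length v = i + j"
    using length_subst_binary[OF v, of "\<lambda>x. [x]"] by (simp add: i_def j_def)
  then have ij: "i + j < N" "length u = i + j" using len N by simp_all
  have "length ?w = (N + i) * length s + (N + j) * length t"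
    unfolding eq[symmetric]
    by (simp add: length_subst_binary[OF v] subst_replicate s_def t_def i_def j_def length_concat
        sum_list_replicate algebra_simps)
  then have L: "(N + i) * length s + (N + j) * length t = 2 * N + i + j" using ij by simp
  have eq': "concat (replicate N s) @ subst \<phi> v @ concat (replicate N t) = ?w"
    using eq by (simp add: subst_replicate s_def t_def)
  have vw: "set (subst \<phi> v) \<subseteq> set s \<union> set t"
    using v by (induction v) (auto simp: s_def t_def)
  have w: "set ?w \<subseteq> set s \<union> set t" unfolding eq'[symmetric] using vw by auto
  have s0: "set s \<subseteq> {0}" if "length s \<le> N"
  proof -
    have "s = take (length s) ?w" unfolding eq'[symmetric] by (simp add: N')
    also have "\<dots> = replicate (length s) 0" using that by simp
    finally show ?thesis by (metis set_replicate_conv_if empty_subsetI order_refl)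
  qed
  have t1: "set t \<subseteq> {1}" if "length t \<le> N"
  proof -
    have "concat (replicate N t) = concat (replicate N' t @ [t])"
      unfolding replicate_append_same N' by simp
    then have "concat (replicate N t) = concat (replicate N' t) @ t" by simp
    then have "rev t = take (length t) (rev ?w)" unfolding eq'[symmetric] by simp
    also have "\<dots> = replicate (length t) 1" using that by simp
    finally show ?thesis by (metis set_rev set_replicate_conv_if empty_subsetI order_refl)
  qed
  have "0 \<in> set ?w" "1 \<in> set ?w" by (simp_all add: N')
  consider "s = []" | "t = []" | "s \<noteq> []" "t \<noteq> []" by blast
  then show False
  proof cases
    case 1
    then have "(N + j) * length t < (N + j) * 3" using L ij by simp
    then have "length t < 3" by (metis mult_less_cancel1)
    then have "length t \<le> N" using N by simp
    from t1[OF this] show False using w 1 \<open>0 \<in> set ?w\<close> by auto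
  next
    case 2
    then have "(N + i) * length s < (N + i) * 3" using L ij by simp
    then have "length s < 3" by (metis mult_less_cancel1)
    then have "length s \<le> N" using N by simp
    from s0[OF this] show False using w 2 \<open>1 \<in> set ?w\<close> by auto
  next
    case 3
    have sandwich: "X = X' \<and> Y = Y'" if "X + Y = X' + Y'" "X' \<le> X" "Y' \<le> Y" for X X' Y Y' :: nat
      using that by linarith
    have "(N + i) * length s + (N + j) * length t = (N + i) * 1 + (N + j) * 1" using L by simp
    moreover have "(N + i) * 1 \<le> (N + i) * length s" "(N + j) * 1 \<le> (N + j) * length t"
      using 3 by (simp_all only: mult_le_mono2 length_greater_0_conv[symmetric] Suc_le_eq One_nat_def)
    ultimately have "(N + i) * length s = (N + i) * 1 \<and> (N + j) * length t = (N + j) * 1"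
      by (rule sandwich)
    then have "length s = 1" "length t = 1" using N by simp_all
    then have st: "s = [0]" "t = [1]" using s0 t1 N by (auto simp: length_Suc_conv)
    have "subst \<phi> v = subst (\<lambda>x. [x]) v"
      using v st by (intro subst_cong) (auto simp: s_def t_def)
    then have "subst \<phi> v = v" by simp
    then show False using eq' st uv by simp
  qed
qed

text \<open>
  An identity in which the two sides contain some letter with different frequencies yields two powers
  by erasing the other letters. If all identities of \<open>V\<close> were balanced, a nontrivial one would
  give, after projecting to two letters and attaching long powers at the ends, an instance of the
  lemma on power frames, whose conclusion is not balanced.
\<close>

lemma distinct_powers:
  fixes V :: "('a::infinite) monoid set"
  assumes V: "modular_element MON V" and proper: "V \<noteq> all_monoids"
  shows "\<exists>k n. k < n \<and> satisfies_identity V (replicate k 0) (replicate n 0)"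
proof -
  have var: "monoid_variety V" using V by (simp add: modular_element_def MON_def)
  then have Vm: "V \<subseteq> all_monoids" by (rule monoid_variety_subset)
  obtain u v where uv: "u \<noteq> v" "satisfies_identity V u v"
  proof -
    obtain \<Sigma> where \<Sigma>: "V = models_of \<Sigma>" using var by (auto simp: monoid_variety_def)
    obtain M where "M \<in> all_monoids" "M \<notin> V" using Vm proper by blast
    then obtain u v where "(u, v) \<in> \<Sigma>" "\<not> holds_in M u v" by (auto simp: models_of_def \<Sigma>)
    moreover from this have "u \<noteq> v" by (auto simp: holds_in_def)
    moreover from \<open>(u, v) \<in> \<Sigma>\<close> have "satisfies_identity V u v"
      by (auto simp: \<Sigma> satisfies_identity_def models_of_def)
    ultimately show thesis using that by blast
  qed
  have "\<exists>s t x. satisfies_identity V s t \<and> count_list s x \<noteq> count_list t x"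
  proof (rule ccontr)
    assume "\<not> ?thesis"
    then have bal: "count_list s x = count_list t x" if "satisfies_identity V s t" for s t x
      using that by blast
    obtain x y where xy: "subst (projection x y) u \<noteq> subst (projection x y) v"
      using distinguishing_projection[OF uv(1) bal[OF uv(2)]] by blast
    define u1 v1 where "u1 = subst (projection x y) u" and "v1 = subst (projection x y) v"
    have sat1: "satisfies_identity V u1 v1"
      unfolding u1_def v1_def by (rule satisfies_identity_subst[OF Vm uv(2)])
    have bin: "set (subst (projection x y) w) \<subseteq> {0, 1}" for w
      by (auto simp: subst_def projection_def)
    have len: "length w = count_list w 0 + count_list w 1" if "set w \<subseteq> {0, 1}" for w :: word
      using length_subst_binary[OF that, of "\<lambda>x. [x]"] by simp
    have "length v1 = length u1"
      using len[OF bin] bal[OF sat1] by (simp add: u1_def v1_def)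
    define N where "N = length u1 + 2"
    define u2 v2 where "u2 = replicate N 0 @ u1 @ replicate N 1" and "v2 = replicate N 0 @ v1 @ replicate N 1"
    have "satisfies_identity V u2 v2"
      unfolding u2_def v2_def by (rule satisfies_identity_context[OF Vm sat1])
    moreover have "2 \<notin> set u2" using bin[of u] by (auto simp: u2_def u1_def[symmetric])
    moreover have "u2 \<noteq> []" by (simp add: u2_def N_def)
    moreover have "subst \<phi> v2 \<noteq> u2" for \<phi>
      unfolding u2_def v2_def
      using bin[of v] xy \<open>length v1 = length u1\<close>
      by (intro subst_pinned) (simp_all add: u1_def v1_def N_def)
    ultimately have "satisfies_identity V (replicate (2 * r + 2) 2) (replicate (2 * r + 1) 2)"
      if "length u2 < r" "2 \<le> r" for r
      using power_frame[OF V _ _ _ that, where v = v2 and a = 2] by blast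
    from this[of "length u2 + 2"]
    have "satisfies_identity V (replicate (2 * (length u2 + 2) + 2) 2) (replicate (2 * (length u2 + 2) + 1) 2)"
      by simp
    from bal[OF this, of 2] show False by (simp add: count_list_replicate del: replicate_Suc)
  qed
  then obtain s t x where st: "satisfies_identity V s t" "count_list s x \<noteq> count_list t x" by blast
  have pow: "subst (\<lambda>y. if y = x then [0] else []) w = replicate (count_list w x) 0" for w
    by (induction w) auto
  have "satisfies_identity V (replicate (count_list s x) 0) (replicate (count_list t x) 0)"
    using satisfies_identity_subst[OF Vm st(1), of "\<lambda>y. if y = x then [0] else []"] by (simp add: pow)
  then show ?thesis using st(2) satisfies_identity_sym by (metis linorder_neqE_nat)
qed

section \<open>A square-free identity\<close>

lemma rev_subst: "rev (subst \<phi> w) = subst (\<lambda>x. rev (\<phi> x)) (rev w)"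
  by (induction w) auto

lemma subst_power_of_letter:
  assumes "\<And>y. y \<in> set w \<Longrightarrow> set (\<phi> y) \<subseteq> {x}"
  shows "subst \<phi> w = replicate (length (subst \<phi> w)) x"
proof -
  have "set (subst \<phi> w) \<subseteq> {x}" using assms by (auto simp: subst_def)
  then show ?thesis by (metis replicate_eqI singletonD subsetD)
qed

lemma length_subst_rev: "length (subst \<phi> (rev w)) = length (subst \<phi> w)"
  by (induction w) auto

lemma replicate_block_unique:
  assumes "u @ replicate k x @ v = A @ replicate k x @ B" "x \<notin> set u" "x \<notin> set A" "k > 0"
  shows "u = A \<and> v = B"
proof -
  obtain k' where k: "k = Suc k'" using assms(4) by (cases k) auto
  have "takeWhile (\<lambda>y. y \<noteq> x) (w @ x # z) = w" if "x \<notin> set w" for w z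
    using that by (subst takeWhile_append2) auto
  from this[OF assms(2)] this[OF assms(3)] have "u = A"
    using assms(1) by (metis append_Cons k replicate_Suc)
  then show ?thesis using assms(1) by simp
qed

text \<open>
  Two occurrences of a word containing \<open>l\<close> must each cover one of the two outer letters, so the
  whole block of \<open>x\<close> lies between them. Applied to the projections of a word to \<open>l\<close> and \<open>x\<close>.
\<close>

lemma block_between_letters:
  assumes eq: "u @ s @ m @ s @ v = l # replicate k x @ [l]" and "l \<in> set s" "l \<noteq> x"
  shows "u = [] \<and> s = [l] \<and> m = replicate k x \<and> v = []"
proof -
  have "count_list (u @ s @ m @ s @ v) l = 2"
    using \<open>l \<noteq> x\<close> by (simp add: eq count_list_0_iff)
  moreover have "count_list s l \<noteq> 0" using \<open>l \<in> set s\<close> by (simp add: count_list_0_iff)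
  ultimately have "count_list u l = 0" "count_list v l = 0" and s1: "count_list s l = 1" by simp_all
  then have uv: "l \<notin> set u" "l \<notin> set v" by (simp_all add: count_list_0_iff)
  obtain s1 s2 where s: "s = s1 @ l # s2" using \<open>l \<in> set s\<close> by (meson split_list)
  then have s12: "l \<notin> set s1" "l \<notin> set s2" using s1 by (simp_all add: count_list_0_iff)
  have "u @ s1 = []"
  proof (rule ccontr)
    assume "u @ s1 \<noteq> []"
    then have "hd (u @ s @ m @ s @ v) \<in> set (u @ s1)"
      unfolding s by (metis append.assoc hd_append2 hd_in_set)
    then show False using eq uv s12 by auto
  qed
  moreover have "s2 @ v = []"
  proof (rule ccontr)
    assume n: "s2 @ v \<noteq> []"
    have "last (u @ s @ m @ s @ v) = last ((u @ s @ m @ s1 @ [l]) @ s2 @ v)" by (simp add: s)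
    also have "\<dots> = last (s2 @ v)" using n by (rule last_appendR)
    finally have "last (u @ s @ m @ s @ v) \<in> set (s2 @ v)" using n by (metis last_in_set)
    then show False using eq uv s12 by auto
  qed
  ultimately show ?thesis using eq s by simp
qed

text \<open>
  Three small word equations: with \<open>abc\<close> and \<open>acb\<close> on the two sides of the block, the letters are
  all erased or all fixed; in the reversed frame they can only be erased; and a nonempty suffix
  of the left side is never a prefix of the right side.
\<close>

lemma rigid_frame:
  assumes "c @ a @ b @ g = [0,1,2::nat]" "a @ g @ b @ d = [0,2,1]"
  shows "a = [] \<and> b = [] \<and> g = [] \<or> c = [] \<and> d = [] \<and> a = [0] \<and> b = [1] \<and> g = [2]"
  using assms(1) unfolding append_eq_Cons_conv append_is_Nil_conv
  by (elim exE disjE conjE; insert assms(2); simp)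

lemma no_reversed_frame:
  assumes "c @ a @ b @ g = [1,2,0::nat]" "a @ g @ b @ d = [2,1,0]"
  shows "a = [] \<and> b = [] \<and> g = []"
  using assms(1) unfolding append_eq_Cons_conv append_is_Nil_conv
  by (elim exE disjE conjE; insert assms(2); simp)

lemma no_suffix_is_prefix:
  assumes "c @ b = A" "b @ d = B"
    and AB: "A = [0,1,2::nat] \<and> B = [0,2,1] \<or> A = [1,2,0] \<and> B = [2,1,0]"
  shows "b = []"
  using AB rigid_frame[of c "[]" b "[]" d] no_reversed_frame[of c "[]" b "[]" d] assms(1,2)
  by auto

text \<open>
  Let \<open>w = abc x\<^sup>n acb\<close>, the letters \<open>a\<close>, \<open>b\<close>, \<open>c\<close>, \<open>x\<close> being \<open>0\<close>, \<open>1\<close>, \<open>2\<close>, \<open>3\<close>. Unless it fixes all letters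
  and \<open>n = k\<close>, a substitution that embeds \<open>w\<close> into \<open>abc x\<^sup>k acb\<close> or its reversal does not see the
  difference between \<open>w\<close> and its reversal.

  If \<open>x\<close> is not erased, the square of its image is a factor, so the image is a power of \<open>x\<close>, and by
  counting it is \<open>x\<close> itself and \<open>n = k\<close>; the rest is rigid. If \<open>x\<close> is erased, then \<open>abcacb\<close> is
  embedded. An image containing a letter other than \<open>x\<close> occurs twice, with all of \<open>x\<^sup>k\<close> between these occurrences. For \<open>a\<close> and \<open>c\<close>
  this is impossible, since \<open>b\<close> and \<open>c\<close>, respectively \<open>a\<close>, also occur elsewhere. For \<open>b\<close> it makes the
  image both a suffix of the left and a prefix of the right side of the block. So all images are
  powers of \<open>x\<close>, which commute.
\<close>

lemma block_word_occurrence: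
  assumes AB: "A = [0,1,2] \<and> B = [0,2,1] \<or> A = [1,2,0] \<and> B = [2,1,0]"
    and k: "2 \<le> k" "k \<le> n"
    and w: "w = [0,1,2] @ replicate n 3 @ [0,2,1]"
    and eq: "c @ subst \<phi> w @ d = A @ replicate k 3 @ B"
  shows "subst \<phi> w = subst \<phi> (rev w) \<or>
     n = k \<and> A = [0,1,2] \<and> c = [] \<and> d = [] \<and> (\<forall>x \<in> set w. \<phi> x = [x])"
proof -
  define a b g e where "a = \<phi> 0" and "b = \<phi> 1" and "g = \<phi> 2" and "e = \<phi> 3"
  note defs = a_def b_def g_def e_def
  define E where "E = concat (replicate n e)"
  have eq': "c @ a @ b @ g @ E @ a @ g @ b @ d = A @ replicate k 3 @ B"
    using eq by (simp add: w defs E_def subst_replicate)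
  have three: "3 \<notin> set A" "3 \<notin> set B" using AB by auto
  have letters: "set (c @ a @ b @ g @ E @ a @ g @ b @ d) \<subseteq> {0,1,2,3}"
    unfolding eq' using AB by auto
  \<comment> \<open>In the projection to \<open>l\<close> and \<open>x\<close>, the word consists of the block between two \<open>l\<close>.\<close>
  define F where "F l = filter (\<lambda>y. y = l \<or> y = (3::nat))" for l
  have F: "F l c @ F l a @ F l b @ F l g @ F l E @ F l a @ F l g @ F l b @ F l d =
      l # replicate k 3 @ [l]" if "l \<in> {0,1,2}" for l
  proof -
    have "F l (A @ replicate k 3 @ B) = l # replicate k 3 @ [l]"
      using AB that by (auto simp: F_def filter_replicate)
    then show ?thesis unfolding eq'[symmetric] by (simp add: F_def)
  qed
  have inF: "l \<in> set (F l s) \<longleftrightarrow> l \<in> set s" for l s by (auto simp: F_def)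
  have e3: "set e \<subseteq> {3}"
  proof -
    obtain n' where n: "n = Suc (Suc n')" using k by (metis add_2_eq_Suc le_Suc_ex le_trans)
    have "l \<notin> set e" if l: "l \<in> {0,1,2}" for l
    proof
      assume "l \<in> set e"
      have "(F l c @ F l a @ F l b @ F l g) @ F l e @ [] @ F l e @
          (F l (concat (replicate n' e)) @ F l a @ F l g @ F l b @ F l d) = l # replicate k 3 @ [l]"
        using F[OF l] by (simp add: E_def n F_def)
      from block_between_letters[OF this] show False using l k inF \<open>l \<in> set e\<close> by auto
    qed
    moreover have "set e \<subseteq> {0,1,2,3}" using letters by (auto simp: E_def n)
    ultimately show ?thesis by auto
  qed
  then obtain j where j: "e = replicate j 3" by (metis replicate_eqI singletonD subsetD)
  have cnt: "count_list (c @ a @ b @ g @ E @ a @ g @ b @ d) 3 = k"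
    unfolding eq' using three by (simp add: count_list_0_iff count_list_replicate)
  have E: "E = replicate (n * j) 3" unfolding E_def j by (induction n) (auto simp: replicate_add)
  show ?thesis
  proof (cases "j = 0")
    case False
    have "count_list E 3 = n * j" by (simp add: E count_list_replicate)
    then have "n * j \<le> k" using cnt by simp
    moreover have "n \<le> n * j" using False by simp
    ultimately have nk: "n * j = k" "n = k" using k by linarith+
    then have j1: "j = 1" using k by simp
    have "count_list E 3 = k" using \<open>count_list E 3 = n * j\<close> nk by simp
    then have "count_list (c @ a @ b @ g) 3 = 0" using cnt by simp
    then have no3: "3 \<notin> set (c @ a @ b @ g)" by (simp add: count_list_0_iff)
    have "(c @ a @ b @ g) @ replicate k 3 @ (a @ g @ b @ d) = A @ replicate k 3 @ B"
      using eq' E nk(2) j1 by simp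
    from replicate_block_unique[OF this no3 three(1)] have "c @ a @ b @ g = A \<and> a @ g @ b @ d = B"
      using k by (metis less_le_trans pos2)
    then have "a = [] \<and> b = [] \<and> g = [] \<or> A = [0,1,2] \<and> c = [] \<and> d = [] \<and> a = [0] \<and> b = [1] \<and> g = [2]"
      using AB rigid_frame[of c a b g d] no_reversed_frame[of c a b g d] by auto
    then show ?thesis
    proof
      assume "a = [] \<and> b = [] \<and> g = []"
      then have "subst \<phi> w = subst \<phi> (rev w)" by (simp add: w defs)
      then show ?thesis ..
    next
      assume "A = [0,1,2] \<and> c = [] \<and> d = [] \<and> a = [0] \<and> b = [1] \<and> g = [2]"
      then show ?thesis using nk j j1 by (auto simp: w defs)
    qed
  next
    case True
    then have e: "e = []" "E = []" using j E by simp_all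
    have ag: "l \<notin> set a" "l \<notin> set g" if l: "l \<in> {0,1,2}" for l
    proof -
      show "l \<notin> set a"
      proof
        assume "l \<in> set a"
        have "F l c @ F l a @ (F l b @ F l g) @ F l a @ (F l g @ F l b @ F l d) = l # replicate k 3 @ [l]"
          using F[OF l] e by (simp add: F_def)
        from block_between_letters[OF this] show False using l k inF \<open>l \<in> set a\<close> by auto
      qed
      show "l \<notin> set g"
      proof
        assume "l \<in> set g"
        have "(F l c @ F l a @ F l b) @ F l g @ F l a @ F l g @ (F l b @ F l d) = l # replicate k 3 @ [l]"
          using F[OF l] e by (simp add: F_def)
        from block_between_letters[OF this] show False using l k inF \<open>l \<in> set g\<close> by auto
      qed
    qed
    then have ag3: "set a \<subseteq> {3}" "set g \<subseteq> {3}" using letters by auto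
    have b: "l \<notin> set b" if l: "l \<in> {0,1,2}" for l
    proof
      assume lb: "l \<in> set b"
      have "(F l c @ F l a) @ F l b @ (F l g @ F l a @ F l g) @ F l b @ F l d = l # replicate k 3 @ [l]"
        using F[OF l] e by (simp add: F_def)
      from block_between_letters[OF this] have "F l a = []" "F l b = [l]" and
        gg: "F l g @ F l a @ F l g = replicate k 3" "F l c = []"
        using l lb inF by auto
      moreover have "F l a = a" "F l g = g" using ag3 by (auto simp: F_def filter_id_conv)
      ultimately have "a = []" "g @ g = replicate k 3" by simp_all
      have "3 \<notin> set (F l b)" "3 \<notin> set (F l c)" using \<open>F l b = [l]\<close> \<open>F l c = []\<close> l by auto
      then have "3 \<notin> set (c @ b)" by (simp add: F_def)
      moreover have "(c @ b) @ replicate k 3 @ (b @ d) = A @ replicate k 3 @ B"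
        using eq' e \<open>a = []\<close> \<open>g @ g = replicate k 3\<close> by (metis append_Nil append_assoc)
      ultimately have "c @ b = A" "b @ d = B" using replicate_block_unique three k
        by (metis less_le_trans pos2)+
      then have "b = []" using AB no_suffix_is_prefix by blast
      then show False using lb by simp
    qed
    then have "set b \<subseteq> {3}" using letters by auto
    then have w3: "set (\<phi> y) \<subseteq> {3}" if "y \<in> set w" for y
      using that ag3 e3 by (auto simp: w defs split: if_splits)
    then have "subst \<phi> w = replicate (length (subst \<phi> w)) 3"
      by (rule subst_power_of_letter)
    moreover have "subst \<phi> (rev w) = replicate (length (subst \<phi> (rev w))) 3"
      by (rule subst_power_of_letter) (simp add: w3)
    ultimately show ?thesis by (metis length_subst_rev)
  qed
qed

text \<open>
  Separation applied to \<open>p = abc x\<^sup>k acb\<close> and its reversal, with \<open>x\<^sup>n\<close> in place of \<open>x\<^sup>k\<close> in \<open>p'\<close> and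
  \<open>q'\<close>; then \<open>x\<close> is erased. The point of the resulting identity is that its sides are square-free.
\<close>

lemma commuting_word:
  fixes V :: "('a::infinite) monoid set"
  assumes V: "modular_element MON V" and kn: "2 \<le> k" "k < n"
    and pow: "satisfies_identity V (replicate k 0) (replicate n 0)"
  shows "satisfies_identity V [0, 1, 2, 0, 2, 1] [1, 2, 0, 2, 1, 0]"
proof -
  have Vm: "V \<subseteq> all_monoids" using V by (rule modular_element_MON_subset)
  define w where "w m = [0,1,2] @ replicate m 3 @ [0,2,1::nat]" for m
  have rw: "rev (w m) = [1,2,0] @ replicate m 3 @ [2,1,0]" for m by (simp add: w_def)
  let ?T = "{w k, rev (w k)}"
  have pow3: "satisfies_identity V (replicate k 3) (replicate n 3)"
    using satisfies_identity_subst[OF Vm pow, of "\<lambda>_. [3]"] by (simp add: subst_def)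
  have occ: "subst \<phi> (w m) = subst \<phi> (rev (w m)) \<or>
      m = k \<and> t = w k \<and> c = [] \<and> d = [] \<and> (\<forall>x \<in> set (w m). \<phi> x = [x])"
    if "c @ subst \<phi> (w m) @ d = t" "t \<in> ?T" "k \<le> m" for c \<phi> d t m
  proof -
    from that(2) have "t = [0,1,2] @ replicate k 3 @ [0,2,1] \<or> t = [1,2,0] @ replicate k 3 @ [2,1,0]"
      unfolding rw by (simp add: w_def)
    then obtain A B where AB: "A = [0,1,2] \<and> B = [0,2,1] \<or> A = [1,2,0] \<and> B = [2,1,0]"
      and t: "t = A @ replicate k 3 @ B" by blast
    have "t = w k" if "A = [0,1,2]" using AB t that by (auto simp: w_def)
    then show ?thesis
      using block_word_occurrence[OF AB kn(1) that(3) w_def, of c \<phi> d] that(1) unfolding t by blast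
  qed
  have revT: "rev t \<in> ?T" if "t \<in> ?T" for t using that by auto
  \<comment> \<open>Reversing all words turns the facts about \<open>w\<close> into those about its reversal.\<close>
  have reversed: "rev (c @ subst \<phi> v @ d) = rev d @ subst (\<lambda>x. rev (\<phi> x)) (rev v) @ rev c" for c \<phi> v d
    by (simp add: rev_subst)
  have fwd: "c @ subst \<phi> (rev (w k)) @ d \<in> ?T" if T: "c @ subst \<phi> (w k) @ d \<in> ?T" for c \<phi> d
  proof (cases "subst \<phi> (w k) = subst \<phi> (rev (w k))")
    case True
    then show ?thesis using T by simp
  next
    case False
    then have cd: "c = []" "d = []" "\<forall>x \<in> set (rev (w k)). \<phi> x = [x]"
      using occ[OF refl T] by simp_all
    then have "subst \<phi> (rev (w k)) = subst (\<lambda>x. [x]) (rev (w k))" by (intro subst_cong) blast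
    then show ?thesis using cd by simp
  qed
  have "satisfies_identity V (w k) (rev (w k))"
  proof (rule modular_separation[OF V])
    show "satisfies_identity V (w k) (w n)"
      unfolding w_def by (rule satisfies_identity_context[OF Vm pow3])
    show "satisfies_identity V (rev (w k)) (rev (w n))"
      unfolding rw by (rule satisfies_identity_context[OF Vm pow3])
    have "c @ subst \<phi> (w k) @ d \<in> ?T" if T: "c @ subst \<phi> (rev (w k)) @ d \<in> ?T" for c \<phi> d
    proof -
      have "rev (c @ subst \<phi> (rev (w k)) @ d) \<in> ?T" using T by (rule revT)
      then have "rev d @ subst (\<lambda>x. rev (\<phi> x)) (rev (w k)) @ rev c \<in> ?T"
        unfolding reversed rev_rev_ident by (rule fwd)
      then have "rev (c @ subst \<phi> (w k) @ d) \<in> ?T" unfolding reversed .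
      from revT[OF this] show ?thesis by (simp only: rev_rev_ident)
    qed
    then have "c @ subst \<phi> (w k) @ d \<in> ?T \<longleftrightarrow> c @ subst \<phi> (rev (w k)) @ d \<in> ?T" for c \<phi> d
      using fwd by blast
    then show "(w k, rev (w k)) \<in> invariant_core (\<lambda>v. v \<in> ?T)"
      unfolding invariant_core_def by blast
    have same: "subst \<phi> (w n) = subst \<phi> (rev (w n))" if "c @ subst \<phi> (w n) @ d \<in> ?T" for c \<phi> d
      using occ[OF refl that] kn by auto
    have same': "subst \<phi> (w n) = subst \<phi> (rev (w n))" if T: "c @ subst \<phi> (rev (w n)) @ d \<in> ?T" for c \<phi> d
    proof -
      have "rev (c @ subst \<phi> (rev (w n)) @ d) \<in> ?T" using T by (rule revT)
      then have "subst (\<lambda>x. rev (\<phi> x)) (w n) = subst (\<lambda>x. rev (\<phi> x)) (rev (w n))"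
        unfolding reversed rev_rev_ident by (rule same)
      then have "rev (subst \<phi> (rev (w n))) = rev (subst \<phi> (w n))" by (simp add: rev_subst)
      then show ?thesis by simp
    qed
    have "(c @ subst \<phi> (w n) @ d = w k \<longleftrightarrow> c @ subst \<phi> (rev (w n)) @ d = w k) \<and>
        (c @ subst \<phi> (w n) @ d = rev (w k) \<longleftrightarrow> c @ subst \<phi> (rev (w n)) @ d = rev (w k))" for c \<phi> d
    proof (cases "subst \<phi> (w n) = subst \<phi> (rev (w n))")
      case True
      then show ?thesis by (simp only: simp_thms)
    next
      case False
      then show ?thesis using same same' by blast
    qed
    then show "(w n, rev (w n)) \<in> invariant_core (\<lambda>v. (v = w k, v = rev (w k)))"
      unfolding invariant_core_def by blast
  qed
  from satisfies_identity_subst[OF Vm this, of "\<lambda>x. if x = 3 then [] else [x]"]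
  show ?thesis by (simp add: w_def subst_replicate)
qed

section \<open>Searching for occurrences of images\<close>

text \<open>
  For fixed words, membership in the cores is a finite question, settled here by an exhaustive
  search for the ways to embed one word into another by a substitution.

  A result \<open>(\<sigma>', d)\<close> of \<open>prefix_matches u w \<sigma>\<close> says that \<open>w\<close> is the image of \<open>u\<close> under \<open>\<sigma>'\<close>, an extension
  of \<open>\<sigma>\<close>, followed by \<open>d\<close>. A letter that occurs again in \<open>u\<close> gets only images that recur in the
  rest of the word; without this pruning the search would be far too large.
\<close>

fun prefix_matches :: "word \<Rightarrow> word \<Rightarrow> (nat \<times> word) list \<Rightarrow> ((nat \<times> word) list \<times> word) list" where
  "prefix_matches [] w \<sigma> = [(\<sigma>, w)]"
| "prefix_matches (x # u) w \<sigma> = (case map_of \<sigma> x of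
     Some s \<Rightarrow> (if prefix s w then prefix_matches u (drop (length s) w) \<sigma> else [])
   | None \<Rightarrow> concat (map (\<lambda>i. let s = take i w; r = drop i w in
       if x \<notin> set u \<or> sublist s r then prefix_matches u r ((x, s) # \<sigma>) else []) [0..<Suc (length w)]))"

definition extends :: "(nat \<Rightarrow> word) \<Rightarrow> (nat \<times> word) list \<Rightarrow> bool" where
  "extends \<phi> \<sigma> \<longleftrightarrow> (\<forall>(x, s) \<in> set \<sigma>. \<phi> x = s)"

lemma sublist_subst: "x \<in> set u \<Longrightarrow> sublist (\<phi> x) (subst \<phi> u @ d)"
proof -
  assume "x \<in> set u"
  then obtain u1 u2 where "u = u1 @ x # u2" by (auto dest: split_list)
  then show ?thesis by (auto simp: sublist_def)
qed

text \<open>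
  The pruning loses nothing: if \<open>x\<close> occurs in the rest of \<open>u\<close>, then \<open>\<phi> x\<close> is a factor of its image.
\<close>

lemma prefix_matches_complete:
  assumes "subst \<phi> u @ d = w" "extends \<phi> \<sigma>"
  shows "\<exists>\<sigma>'. (\<sigma>', d) \<in> set (prefix_matches u w \<sigma>) \<and> extends \<phi> \<sigma>' \<and> set u \<union> fst ` set \<sigma> \<subseteq> fst ` set \<sigma>'"
  using assms
proof (induction u arbitrary: w \<sigma>)
  case Nil
  then show ?case by auto
next
  case (Cons x u)
  let ?r = "subst \<phi> u @ d"
  have w: "w = \<phi> x @ ?r" using Cons.prems by simp
  show ?case
  proof (cases "map_of \<sigma> x")
    case None
    have "extends \<phi> ((x, \<phi> x) # \<sigma>)" using Cons.prems by (simp add: extends_def)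
    from Cons.IH[OF refl this] obtain \<sigma>' where \<sigma>':
      "(\<sigma>', d) \<in> set (prefix_matches u ?r ((x, \<phi> x) # \<sigma>))" "extends \<phi> \<sigma>'"
      "set u \<union> fst ` set ((x, \<phi> x) # \<sigma>) \<subseteq> fst ` set \<sigma>'" by blast
    have "length (\<phi> x) \<in> set [0..<Suc (length w)]" using w by simp
    moreover have "x \<notin> set u \<or> sublist (\<phi> x) ?r" using sublist_subst by blast
    moreover have "take (length (\<phi> x)) w = \<phi> x" "drop (length (\<phi> x)) w = ?r" using w by simp_all
    ultimately have "(\<sigma>', d) \<in> set (prefix_matches (x # u) w \<sigma>)"
      using \<sigma>'(1) None by (force simp: Let_def simp del: upt_Suc)
    then show ?thesis using \<sigma>' by auto
  next
    case (Some s)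
    then have "(x, s) \<in> set \<sigma>" by (rule map_of_SomeD)
    then have "s = \<phi> x" using Cons.prems by (auto simp: extends_def)
    then have "prefix_matches (x # u) w \<sigma> = prefix_matches u ?r \<sigma>" using Some w by simp
    moreover have "x \<in> fst ` set \<sigma>" using \<open>(x, s) \<in> set \<sigma>\<close> by force
    moreover obtain \<sigma>' where \<sigma>': "(\<sigma>', d) \<in> set (prefix_matches u ?r \<sigma>)" "extends \<phi> \<sigma>'"
      "set u \<union> fst ` set \<sigma> \<subseteq> fst ` set \<sigma>'" using Cons.IH[OF refl Cons.prems(2)] by blast
    ultimately have "(\<sigma>', d) \<in> set (prefix_matches (x # u) w \<sigma>)" "set (x # u) \<union> fst ` set \<sigma> \<subseteq> fst ` set \<sigma>'"
      by auto
    then show ?thesis using \<sigma>'(2) by blast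
  qed
qed

definition apply_match :: "(nat \<times> word) list \<Rightarrow> word \<Rightarrow> word" where
  "apply_match \<sigma> = subst (\<lambda>x. case map_of \<sigma> x of Some s \<Rightarrow> s | None \<Rightarrow> [])"

lemma apply_match:
  assumes "extends \<phi> \<sigma>" "set w \<subseteq> fst ` set \<sigma>"
  shows "apply_match \<sigma> w = subst \<phi> w"
  unfolding apply_match_def
proof (rule subst_cong)
  fix x assume "x \<in> set w"
  then have "map_of \<sigma> x \<noteq> None" using assms(2) by (auto simp: map_of_eq_None_iff)
  then obtain s where "map_of \<sigma> x = Some s" by blast
  then show "(case map_of \<sigma> x of Some s \<Rightarrow> s | None \<Rightarrow> []) = \<phi> x"
    using assms(1) by (auto simp: extends_def dest: map_of_SomeD)
qed

definition all_occurrences :: "(word \<Rightarrow> bool) \<Rightarrow> word \<Rightarrow> word \<Rightarrow> word \<Rightarrow> bool" where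
  "all_occurrences P w u v \<longleftrightarrow> (\<forall>i \<in> set [0..<Suc (length w)].
     \<forall>(\<sigma>, d) \<in> set (prefix_matches u (drop i w) []). P (take i w @ apply_match \<sigma> v @ d))"

lemma all_occurrencesD:
  assumes "all_occurrences P w u v" "c @ subst \<phi> u @ d = w" "set v \<subseteq> set u"
  shows "P (c @ subst \<phi> v @ d)"
proof -
  have "extends \<phi> []" by (simp add: extends_def)
  from prefix_matches_complete[OF refl this, where u = u and d = d] obtain \<sigma> where \<sigma>:
    "(\<sigma>, d) \<in> set (prefix_matches u (subst \<phi> u @ d) [])" "extends \<phi> \<sigma>" "set u \<subseteq> fst ` set \<sigma>" by auto
  have "length c \<in> set [0..<Suc (length w)]" "drop (length c) w = subst \<phi> u @ d" "take (length c) w = c"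
    using assms(2) by auto
  moreover have "\<forall>i \<in> set [0..<Suc (length w)]. \<forall>(\<sigma>, d) \<in> set (prefix_matches u (drop i w) []).
      P (take i w @ apply_match \<sigma> v @ d)"
    using assms(1) by (simp only: all_occurrences_def)
  ultimately have "P (c @ apply_match \<sigma> v @ d)"
    using \<sigma>(1) by (metis (no_types, lifting) case_prodD)
  moreover have "apply_match \<sigma> v = subst \<phi> v" using apply_match \<sigma>(2,3) assms(3) by blast
  ultimately show ?thesis by simp
qed

lemma pair_core_by_search:
  assumes "set p = set q"
    and "all_occurrences (\<lambda>w. w = p \<or> w = q) p p q" "all_occurrences (\<lambda>w. w = p \<or> w = q) q p q"
    and "all_occurrences (\<lambda>w. w = p \<or> w = q) p q p" "all_occurrences (\<lambda>w. w = p \<or> w = q) q q p"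
  shows "(p, q) \<in> invariant_core (\<lambda>w. w \<in> {p, q})"
proof -
  have "c @ subst \<phi> p @ d \<in> {p, q} \<longleftrightarrow> c @ subst \<phi> q @ d \<in> {p, q}" for c \<phi> d
    using assms(2-5)[THEN all_occurrencesD, of c \<phi> d] assms(1) by blast
  then show ?thesis by (simp add: invariant_core_def)
qed

lemma separated_core_by_search:
  assumes "set p' = set q'"
    and "all_occurrences (\<lambda>w. w = p) p p' q'" "all_occurrences (\<lambda>w. w = p) p q' p'"
    and "all_occurrences (\<lambda>w. w = q) q p' q'" "all_occurrences (\<lambda>w. w = q) q q' p'"
  shows "(p', q') \<in> invariant_core (\<lambda>w. (w = p, w = q))"
proof -
  have "(c @ subst \<phi> p' @ d = p \<longleftrightarrow> c @ subst \<phi> q' @ d = p)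
      \<and> (c @ subst \<phi> p' @ d = q \<longleftrightarrow> c @ subst \<phi> q' @ d = q)" for c \<phi> d
    using assms(2-5)[THEN all_occurrencesD, of c \<phi> d] assms(1) by blast
  then show ?thesis by (simp add: invariant_core_def)
qed

section \<open>The two identities\<close>

text \<open>
  Let \<open>W\<close> and \<open>W'\<close> be the sides of the hypothesis, \<open>a\<close>, \<open>b\<close>, \<open>c\<close> the letters \<open>3\<close>, \<open>4\<close>, \<open>5\<close>, and put
  \<open>p = ab W acbc\<close> and \<open>q = aba W cabc\<close>. Both are square-free, and each letter occurs at least
  twice, so its image must be a factor that recurs; little fits. No nonempty suffix of \<open>ab\<close> is a
  prefix of \<open>acbc\<close>, and none of \<open>aba\<close> is one of \<open>cabc\<close>, since otherwise a frame letter that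
  occurs once on each side could embrace \<open>W\<close> with that image while the others are erased. The
  search confirms that a substitution that embeds \<open>p\<close>, \<open>q\<close> or one of their variants with \<open>W'\<close>
  into \<open>p\<close> or \<open>q\<close> either erases \<open>a\<close>, \<open>b\<close> and \<open>c\<close>, and then both frames disappear, or is the
  identity on \<open>p\<close> or \<open>q\<close>. Since \<open>a\<close> occurs twice in \<open>p\<close> and three times in \<open>q\<close>, erasing all other
  letters turns \<open>p \<approx> q\<close> into \<open>x\<^sup>2 \<approx> x\<^sup>3\<close>.
\<close>

lemma squares_idempotent:
  fixes V :: "('a::infinite) monoid set"
  assumes V: "modular_element MON V"
    and W: "satisfies_identity V [0, 1, 2, 0, 2, 1] [1, 2, 0, 2, 1, 0]"
  shows "satisfies_identity V [0, 0] [0, 0, 0]"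
proof -
  have Vm: "V \<subseteq> all_monoids" using V by (rule modular_element_MON_subset)
  let ?p = "[3,4,0,1,2,0,2,1,3,5,4,5] :: word" and ?q = "[3,4,3,0,1,2,0,2,1,5,3,4,5] :: word"
  have "satisfies_identity V ?p ?q"
  proof (rule modular_separation[OF V])
    let ?p' = "[3,4,1,2,0,2,1,0,3,5,4,5] :: word" and ?q' = "[3,4,3,1,2,0,2,1,0,5,3,4,5] :: word"
    show "satisfies_identity V ?p ?p'"
      using satisfies_identity_context[OF Vm W, of "[3,4]" "[3,5,4,5]"] by simp
    show "satisfies_identity V ?q ?q'"
      using satisfies_identity_context[OF Vm W, of "[3,4,3]" "[5,3,4,5]"] by simp
    show "(?p, ?q) \<in> invariant_core (\<lambda>w. w \<in> {?p, ?q})"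
      by (rule pair_core_by_search; code_simp)
    show "(?p', ?q') \<in> invariant_core (\<lambda>w. (w = ?p, w = ?q))"
      by (rule separated_core_by_search; code_simp)
  qed
  from satisfies_identity_subst[OF Vm this, of "\<lambda>x. if x = 3 then [0] else []"]
  show ?thesis by simp
qed

text \<open>
  Since \<open>x\<^sup>2\<close> is the only square in \<open>x\<^sup>2 y\<close> and \<open>y x\<^sup>2\<close>, a substitution of \<open>x\<^sup>2 y\<close> into one of them
  fixes or erases \<open>x\<close>, and exchanging its image with that of \<open>y x\<^sup>2\<close> does not leave the pair; the
  cube in \<open>x\<^sup>3 y\<close> forces it to erase \<open>x\<close>.
\<close>

lemma squares_central:
  fixes V :: "('a::infinite) monoid set"
  assumes V: "modular_element MON V" and sq: "satisfies_identity V [0, 0] [0, 0, 0]"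
  shows "satisfies_identity V [0, 0, 1] [1, 0, 0]"
proof (rule modular_separation[OF V])
  have Vm: "V \<subseteq> all_monoids" using V by (rule modular_element_MON_subset)
  show "satisfies_identity V [0, 0, 1] [0, 0, 0, 1]"
    using satisfies_identity_context[OF Vm sq, of "[]" "[1]"] by simp
  show "satisfies_identity V [1, 0, 0] [1, 0, 0, 0]"
    using satisfies_identity_context[OF Vm sq, of "[1]" "[]"] by simp
  show "([0, 0, 1], [1, 0, 0]) \<in> invariant_core (\<lambda>w. w \<in> {[0, 0, 1], [1, 0, 0]})"
    by (rule pair_core_by_search; code_simp)
  show "([0, 0, 0, 1], [1, 0, 0, 0]) \<in> invariant_core (\<lambda>w. (w = [0, 0, 1], w = [1, 0, 0]))"
    by (rule separated_core_by_search; code_simp)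
qed

theorem proposition4p3:
  fixes V :: "('a::infinite) monoid set"
  assumes "monoid_variety V"
    and "V \<noteq> all_monoids"
    and "modular_element MON V"
  shows "satisfies_identity V [0, 0] [0, 0, 0] \<and> satisfies_identity V [0, 0, 1] [1, 0, 0]"
proof -
  have Vm: "V \<subseteq> all_monoids" using assms(1) by (rule monoid_variety_subset)
  obtain k n where kn: "k < n" "satisfies_identity V (replicate k 0) (replicate n 0)"
    using distinct_powers[OF assms(3,2)] by blast
  \<comment> \<open>An exponent of at least two makes the image of a block a repetition.\<close>
  have "satisfies_identity V (replicate (k + 2) 0) (replicate (n + 2) 0)"
    using satisfies_identity_context[OF Vm kn(2), of "[0, 0]" "[]"] by simp
  then have "satisfies_identity V [0, 1, 2, 0, 2, 1] [1, 2, 0, 2, 1, 0]"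
    using commuting_word[OF assms(3), of "k + 2" "n + 2"] kn(1) by simp
  then have "satisfies_identity V [0, 0] [0, 0, 0]"
    by (rule squares_idempotent[OF assms(3)])
  then show ?thesis using squares_central[OF assms(3)] by blast
qed

end
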